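(* Let $T$ be a tree, endowed with its interval topology. The following properties are equivalent. (a) $T$ is $\mathbb{R}$-embeddable and $|T|\leq 2^{\aleph_0}$. (b) $T$ admits a one-to-one continuous map onto a separable metric space. (c) The one-point compactification $\alpha T$ is a continuous image of a $2$-fibered compact space. (d) $\alpha T$ is $2$-determined.
   Context: All topological spaces are Hausdorff. A tree is a partially ordered set $(T,<)$ with a minimum element $0$ such that for every $t\in T$ the set $[0,t)=\{x\in T: x<t\}$ is well ordered, and every two elements $s,t\in T$ have a greatest lower bound $s\wedge t$. The interval topology on $T$ is generated by the sets $(s,t]=\{x\in T: s<x\leq t\}$ together with $\{0\}$; it is locally compact and every interval $[0,t]$ is compact and open. The one-point compactification is $\alpha T=T\cup\{\infty\}$, where $T$ is an open subspace and basic neighborhoods of $\infty$ are the sets $\alpha T\setminus\bigcup_{i<n}[0,t_i]$ with $n\in\omega$ and $t_0,\dots,t_{n-1}\in T$. $T$ is $\mathbb{R}$-embeddable if there is a function $f:T\to\mathbb{R}$ with $f(s)<f(t)$ whenever $s<t$ in $T$ ($f$ need not be one-to-one). A compact space $K$ is $n$-fibered if there is a continuous map $f:K\to S$ with $S$ second countable and $|f^{-1}(y)|\leq n$ for every $y\in S$. A compact space $K$ is $n$-determined if there are a second countable space $S$ and an upper semicontinuous set-valued map $\Phi$ assigning to each $s\in S$ a subset $\Phi(s)\subseteq K$ with at most $n$ elements, such that $K=\bigcup_{s\in S}\Phi(s)$. (Upper semicontinuous: $\{s\in S:\Phi(s)\subseteq V\}$ is open for each open $V\subseteq K$.) *)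

theory Defs
  imports "HOL-Analysis.Analysis"
begin

text \<open>
  A tree is a type of this class, so that the underlying set \<open>T\<close> is \<open>UNIV\<close>.  The class
  \<open>order_bot\<close> provides the minimum, \<open>semilattice_inf\<close> the greatest lower bounds.
\<close>

class tree = semilattice_inf + order_bot +
  assumes well_order_on_lessThan: "well_order_on {..<t} {(x, y). x \<le> y \<and> y < t}"

definition interval_topology :: "'a::tree topology" where
  "interval_topology = topology_generated_by (insert {bot} {{s<..t} | s t. True})"

abbreviation one_point_compactification :: "'a::tree option topology" where
  "one_point_compactification \<equiv> Alexandroff_compactification interval_topology"

definition R_embeddable :: "'a::tree itself \<Rightarrow> bool" where
  "R_embeddable _ \<longleftrightarrow> (\<exists>f :: 'a \<Rightarrow> real. strict_mono f)"

text \<open>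
  The remaining notions quantify existentially over topological spaces, which in HOL requires
  choosing a type for their points.  A one-to-one continuous image of \<open>X\<close> can be carried by the
  type of \<open>X\<close> itself.  A second countable Hausdorff space has at most continuum many points, and so
  has a space that maps to it with finite fibres; hence the type \<^typ>\<open>real\<close> is large
  enough for both.  The lemmas \<open>condensesI\<close>, \<open>fiberedI\<close>, \<open>determinedI\<close> and
  \<open>image_of_fiberedI\<close> below show that no generality is lost.
\<close>

definition condenses_onto_separable_metric :: "'a topology \<Rightarrow> bool" where
  "condenses_onto_separable_metric X \<longleftrightarrow>
     (\<exists>(M :: 'a topology) f. metrizable_space M \<and> separable_space M \<and>
        continuous_map X M f \<and> inj_on f (topspace X) \<and> f ` topspace X = topspace M)"

definition fibered :: "nat \<Rightarrow> 'k topology \<Rightarrow> bool" where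
  "fibered n K \<longleftrightarrow> compact_space K \<and> Hausdorff_space K \<and>
     (\<exists>(S :: real topology) f. Hausdorff_space S \<and> second_countable S \<and> continuous_map K S f \<and>
        (\<forall>y\<in>topspace S. finite {x \<in> topspace K. f x = y} \<and>
                         card {x \<in> topspace K. f x = y} \<le> n))"

definition upper_semicontinuous :: "'s topology \<Rightarrow> 'k topology \<Rightarrow> ('s \<Rightarrow> 'k set) \<Rightarrow> bool" where
  "upper_semicontinuous S K \<Phi> \<longleftrightarrow>
     (\<forall>V. openin K V \<longrightarrow> openin S {s \<in> topspace S. \<Phi> s \<subseteq> V})"

definition determined :: "nat \<Rightarrow> 'k topology \<Rightarrow> bool" where
  "determined n K \<longleftrightarrow> compact_space K \<and> Hausdorff_space K \<and>
     (\<exists>(S :: real topology) \<Phi>. Hausdorff_space S \<and> second_countable S \<and>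
        (\<forall>s\<in>topspace S. \<Phi> s \<subseteq> topspace K \<and> finite (\<Phi> s) \<and> card (\<Phi> s) \<le> n) \<and>
        upper_semicontinuous S K \<Phi> \<and>
        topspace K = (\<Union>s\<in>topspace S. \<Phi> s))"

definition image_of_fibered :: "nat \<Rightarrow> 'a topology \<Rightarrow> bool" where
  "image_of_fibered n X \<longleftrightarrow>
     (\<exists>(K :: real topology) g. fibered n K \<and> continuous_map K X g \<and>
        g ` topspace K = topspace X)"


subsection \<open>The topologies of a tree\<close>

lemma tree_chain:
  fixes x y t :: "'a::tree"
  assumes "x \<le> t" "y \<le> t"
  shows "x \<le> y \<or> y \<le> x"
proof (cases "x = t \<or> y = t")
  case False
  then have "x \<in> {..<t}" "y \<in> {..<t}" using assms by auto
  moreover have "total_on {..<t} {(x, y). x \<le> y \<and> y < t}"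
    using well_order_on_lessThan[of t] by (simp add: order_on_defs)
  ultimately show ?thesis
    unfolding total_on_def by (metis (mono_tags, lifting) case_prodD mem_Collect_eq order_refl)
qed (use assms in auto)

lemma wf_tree_less: "wf {(x, y). x < (y :: 'a::tree)}"
proof (rule wfI_min)
  fix x :: 'a and Q assume x: "x \<in> Q"
  show "\<exists>z\<in>Q. \<forall>y. (y, z) \<in> {(x, y). x < y} \<longrightarrow> y \<notin> Q"
  proof (cases "Q \<inter> {..<x} = {}")
    case True
    then show ?thesis using x by auto
  next
    case False
    then obtain a where a: "a \<in> Q \<inter> {..<x}" by blast
    have "wf ({(a, y). a \<le> y \<and> y < x} - Id)"
      using well_order_on_lessThan[of x] by (simp add: order_on_defs)
    from wfE_min[OF this a] obtain z where "z \<in> Q" "z < x"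
      and min: "\<And>y. (y, z) \<in> {(a, y). a \<le> y \<and> y < x} - Id \<Longrightarrow> y \<notin> Q \<inter> {..<x}"
      by auto
    moreover have "y \<notin> Q" if "y < z" for y
      using min[of y] that \<open>z < x\<close> order.strict_trans[OF that \<open>z < x\<close>] by (auto simp: less_le)
    ultimately show ?thesis by blast
  qed
qed

lemma openin_interval_topology:
  "openin interval_topology U \<longleftrightarrow>
     (\<forall>t\<in>U. t = bot \<or> (\<exists>s<t. {s<..t} \<subseteq> U))" (is "_ \<longleftrightarrow> ?R U")
proof
  assume "openin interval_topology U"
  then have "generate_topology_on (insert {bot} {{s<..t} | s t. True}) U"
    by (simp add: interval_topology_def openin_topology_generated_by_iff)
  then show "?R U"
  proof induction
    case (Int A B)
    show ?case
    proof
      fix t assume t: "t \<in> A \<inter> B"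
      show "t = bot \<or> (\<exists>s<t. {s<..t} \<subseteq> A \<inter> B)"
      proof (cases "t = bot")
        case False
        then obtain a b where ab: "a < t" "{a<..t} \<subseteq> A" "b < t" "{b<..t} \<subseteq> B"
          using Int t by blast
        then have "a \<le> b \<or> b \<le> a" using tree_chain[of a t b] by auto
        then show ?thesis
        proof
          assume "a \<le> b"
          then have "{b<..t} \<subseteq> {a<..t}" using order.strict_trans1[of a b] by auto
          then have "{b<..t} \<subseteq> A \<inter> B" using ab by blast
          then show ?thesis using ab by blast
        next
          assume "b \<le> a"
          then have "{a<..t} \<subseteq> {b<..t}" using order.strict_trans1[of b a] by auto
          then have "{a<..t} \<subseteq> A \<inter> B" using ab by blast
          then show ?thesis using ab by blast
        qed
      qed simp
    qed
  next
    case (UN K)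
    then show ?case by (meson UnionE Union_upper subset_trans)
  next
    case (Basis A)
    then consider "A = {bot}" | s t where "A = {s<..t}" by blast
    then show ?case
    proof cases
      case 2
      have "{s<..x} \<subseteq> A" "s < x" if "x \<in> A" for x using 2 that by auto
      then show ?thesis by blast
    qed simp
  qed simp
next
  assume R: "?R U"
  show "openin interval_topology U"
  proof (subst openin_subopen, intro ballI)
    fix t assume t: "t \<in> U"
    show "\<exists>V. openin interval_topology V \<and> t \<in> V \<and> V \<subseteq> U"
    proof (cases "t = bot")
      case True
      then have "openin interval_topology {t}"
        unfolding interval_topology_def by (intro topology_generated_by_Basis) simp
      then show ?thesis using t by blast
    next
      case False
      then obtain s where "s < t" "{s<..t} \<subseteq> U" using R t by blast
      moreover have "openin interval_topology {s<..t}"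
        unfolding interval_topology_def by (intro topology_generated_by_Basis) blast
      ultimately show ?thesis by (metis greaterThanAtMost_iff order_refl)
    qed
  qed
qed

lemma topspace_interval_topology [simp]: "topspace interval_topology = UNIV"
proof -
  have "openin interval_topology (UNIV :: 'a set)"
    unfolding openin_interval_topology using bot.not_eq_extremum by blast
  then show ?thesis using openin_subset by blast
qed

lemma openin_interval_atMost: "openin interval_topology {..t}"
  unfolding openin_interval_topology
proof (intro ballI)
  fix x assume "x \<in> {..t}"
  then have "{bot<..x} \<subseteq> {..t}" by (auto intro: order.trans)
  then show "x = bot \<or> (\<exists>s<x. {s<..x} \<subseteq> {..t})" using bot.not_eq_extremum by blast
qed

lemma compactin_interval_atMost: "compactin interval_topology {..t :: 'a::tree}"
proof (induction t rule: wf_induct_rule[OF wf_tree_less])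
  case (1 t)
  show ?case unfolding compactin_def
  proof (intro conjI allI impI)
    fix \<U> :: "'a set set"
    assume U: "Ball \<U> (openin interval_topology) \<and> {..t} \<subseteq> \<Union>\<U>"
    then obtain A where A: "A \<in> \<U>" "t \<in> A" by blast
    show "\<exists>\<F>. finite \<F> \<and> \<F> \<subseteq> \<U> \<and> {..t} \<subseteq> \<Union>\<F>"
    proof (cases "t = bot")
      case True
      then show ?thesis using A by (intro exI[of _ "{A}"]) (auto simp: bot.extremum_unique)
    next
      case False
      then obtain s where s: "s < t" "{s<..t} \<subseteq> A"
        using U A openin_interval_topology by meson
      have "{..s} \<subseteq> \<Union>\<U>"
        using U s by (auto simp: subset_eq intro: order.trans[OF _ order.strict_implies_order])
      then obtain \<F> where F: "finite \<F>" "\<F> \<subseteq> \<U>" "{..s} \<subseteq> \<Union>\<F>"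
        using 1[of s] s U unfolding compactin_def
        by (metis (no_types, lifting) case_prodI mem_Collect_eq)
      have "x \<in> A \<union> \<Union>\<F>" if "x \<le> t" for x
      proof -
        have "x \<le> s \<or> s < x" using tree_chain[of x t s] that s by (auto simp: less_le)
        then show ?thesis using that s F by auto
      qed
      then show ?thesis using A F by (intro exI[of _ "insert A \<F>"]) auto
    qed
  qed simp
qed

lemma Hausdorff_interval_topology: "Hausdorff_space (interval_topology :: 'a::tree topology)"
  unfolding Hausdorff_space_def
proof (intro allI impI)
  fix x y :: 'a
  assume "x \<in> topspace interval_topology \<and> y \<in> topspace interval_topology \<and> x \<noteq> y"
  then have ne: "x \<noteq> y" by simp
  have op: "openin interval_topology {s<..t}" for s t :: 'a
    unfolding interval_topology_def by (intro topology_generated_by_Basis) blast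
  have less: "\<exists>U V. openin interval_topology U \<and> openin interval_topology V \<and> u \<in> U \<and> v \<in> V \<and> disjnt U V"
    if "u < v" for u v :: 'a
    using openin_interval_atMost[of u] op[of u v] that
    by (intro exI[of _ "{..u}"] exI[of _ "{u<..v}"]) (auto simp: disjnt_iff)
  consider "x < y" | "y < x" | "\<not> x \<le> y" "\<not> y \<le> x" using ne by (auto simp: less_le)
  then show "\<exists>U V. openin interval_topology U \<and> openin interval_topology V \<and> x \<in> U \<and> y \<in> V \<and> disjnt U V"
  proof cases
    case 2
    then show ?thesis using less[of y x] by (metis disjnt_sym)
  next
    case 3
    then have "inf x y < x" "inf x y < y" by (metis inf.cobounded1 inf.cobounded2 less_le)+
    moreover have "disjnt {inf x y<..x} {inf x y<..y}"
      by (auto simp: disjnt_iff) (metis inf.bounded_iff less_le_not_le)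
    ultimately show ?thesis using op by (metis greaterThanAtMost_iff order_refl)
  qed (use less in blast)
qed

lemma openin_one_point_compactification:
  "openin one_point_compactification (U :: 'a::tree option set) \<longleftrightarrow>
     openin interval_topology (Some -` U) \<and>
     (None \<in> U \<longrightarrow> (\<exists>F. finite F \<and> - (\<Union>t\<in>F. {..t}) \<subseteq> Some -` U))"
proof (cases "None \<in> U")
  case False
  have U: "U = Some ` (Some -` U)"
  proof (rule set_eqI)
    fix x show "x \<in> U \<longleftrightarrow> x \<in> Some ` (Some -` U)"
      using False by (cases x) auto
  qed
  then show ?thesis using False openin_Alexandroff_compactification_image_Some by metis
next
  case True
  define C where "C = - Some -` U"
  have U: "U = insert None (Some ` (UNIV - C))"
  proof (rule set_eqI)
    fix x show "x \<in> U \<longleftrightarrow> x \<in> insert None (Some ` (UNIV - C))"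
      using True by (cases x) (auto simp: C_def)
  qed
  have "openin one_point_compactification U \<longleftrightarrow>
      compactin interval_topology C \<and> closedin interval_topology C"
  proof
    assume "openin one_point_compactification U"
    then obtain D where D: "compactin interval_topology D" "closedin interval_topology D"
      "U = insert None (Some ` (topspace interval_topology - D))"
      using True by (auto simp: openin_Alexandroff_compactification)
    then have "D = C" by (auto simp: C_def)
    then show "compactin interval_topology C \<and> closedin interval_topology C" using D by simp
  next
    assume "compactin interval_topology C \<and> closedin interval_topology C"
    then show "openin one_point_compactification U"
      using U by (auto simp: openin_Alexandroff_compactification)
  qed
  also have "closedin interval_topology C \<longleftrightarrow> openin interval_topology (Some -` U)"
    by (simp add: C_def closedin_def Compl_eq_Diff_UNIV[symmetric])
  also have "compactin interval_topology C \<and> openin interval_topology (Some -` U) \<longleftrightarrow>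
     openin interval_topology (Some -` U) \<and> (\<exists>F. finite F \<and> - (\<Union>t\<in>F. {..t}) \<subseteq> Some -` U)"
  proof (intro iffI conjI; elim conjE)
    assume "compactin interval_topology C"
    moreover have "\<forall>A\<in>range atMost. openin interval_topology (A :: 'a set)"
      using openin_interval_atMost by blast
    moreover have "C \<subseteq> \<Union>(range atMost)" by auto
    ultimately obtain \<F> where F: "finite \<F>" "\<F> \<subseteq> range atMost" "C \<subseteq> \<Union>\<F>"
      unfolding compactin_def by meson
    then obtain G where "finite G" "\<F> = atMost ` G" by (meson finite_subset_image subset_UNIV)
    moreover from this have "- (\<Union>t\<in>G. {..t}) \<subseteq> Some -` U" using F unfolding C_def by blast
    ultimately show "\<exists>F. finite F \<and> - (\<Union>t\<in>F. {..t}) \<subseteq> Some -` U" by blast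
  next
    assume op: "openin interval_topology (Some -` U)"
      and "\<exists>F. finite F \<and> - (\<Union>t\<in>F. {..t}) \<subseteq> Some -` U"
    then obtain F where "finite F" "- (\<Union>t\<in>F. {..t}) \<subseteq> Some -` U" by blast
    then have F: "finite F" "C \<subseteq> (\<Union>t\<in>F. {..t})" unfolding C_def by blast+
    have "compactin interval_topology (\<Union>t\<in>F. {..t})"
      using F compactin_interval_atMost by (intro compactin_Union) auto
    moreover have "closedin interval_topology C"
      using op by (simp add: C_def closedin_def Compl_eq_Diff_UNIV[symmetric])
    ultimately show "compactin interval_topology C" using F closed_compactin by blast
  qed
  finally show ?thesis using True by simp
qed

lemma Hausdorff_one_point_compactification:
  "Hausdorff_space (one_point_compactification :: 'a::tree option topology)"
proof -
  have "locally_compact_space (interval_topology :: 'a topology)"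
    unfolding locally_compact_space_def
    using openin_interval_atMost compactin_interval_atMost by (metis atMost_iff order_refl)
  then show ?thesis
    using Hausdorff_interval_topology Hausdorff_space_Alexandroff_compactification by blast
qed


subsection \<open>Independence of the types of the quantified spaces\<close>

lemma homeomorphic_copy:
  assumes "inj_on g (topspace X)"
  shows "\<exists>Y. homeomorphic_map X Y g"
proof -
  let ?h = "inv_into (topspace X) g"
  let ?Y = "pullback_topology (g ` topspace X) ?h X"
  have top: "topspace ?Y = g ` topspace X"
    using assms by (auto simp: topspace_pullback_topology)
  have "homeomorphic_maps X ?Y g ?h"
    unfolding homeomorphic_maps_def
  proof (intro conjI ballI)
    show "continuous_map X ?Y g" unfolding continuous_map_def
    proof (intro conjI allI impI)
      show "g \<in> topspace X \<rightarrow> topspace ?Y" by (simp add: top)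
      fix U assume "openin ?Y U"
      then obtain V where V: "openin X V" "U = ?h -` V \<inter> g ` topspace X"
        by (auto simp: openin_pullback_topology)
      have "g x \<in> U \<longleftrightarrow> x \<in> V" if "x \<in> topspace X" for x
        using that assms V(2) by simp
      then have "{x \<in> topspace X. g x \<in> U} = V"
        using openin_subset[OF V(1)] by blast
      then show "openin X {x \<in> topspace X. g x \<in> U}" using V by simp
    qed
    show "continuous_map ?Y X ?h" unfolding continuous_map_def
    proof (intro conjI allI impI)
      show "?h \<in> topspace ?Y \<rightarrow> topspace X" by (auto simp: top inv_into_into)
      fix V assume "openin X V"
      then show "openin ?Y {y \<in> topspace ?Y. ?h y \<in> V}"
        unfolding openin_pullback_topology top by (intro exI[of _ V]) auto
    qed
  qed (use assms in \<open>auto simp: top\<close>)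
  then show ?thesis using homeomorphic_maps_map by blast
qed

lemma second_countable_lepoll_reals:
  fixes S :: "'s topology"
  assumes "Hausdorff_space S" "second_countable S"
  shows "topspace S \<lesssim> (UNIV :: real set)"
proof -
  obtain \<B> where B: "countable \<B>" "\<And>V. V \<in> \<B> \<Longrightarrow> openin S V"
    "\<And>U x. openin S U \<Longrightarrow> x \<in> U \<Longrightarrow> \<exists>V\<in>\<B>. x \<in> V \<and> V \<subseteq> U"
    using assms(2) unfolding second_countable_def by metis
  define c where "c x = to_nat_on \<B> ` {V \<in> \<B>. x \<in> V}" for x
  have "inj_on c (topspace S)"
  proof (rule inj_onI, rule ccontr)
    fix x y assume xy: "x \<in> topspace S" "y \<in> topspace S" "c x = c y" "x \<noteq> y"
    then obtain U V where UV: "openin S U" "openin S V" "x \<in> U" "y \<in> V" "disjnt U V"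
      using assms(1) unfolding Hausdorff_space_def by metis
    then obtain W where W: "W \<in> \<B>" "x \<in> W" "W \<subseteq> U" using B(3) by blast
    then have "to_nat_on \<B> W \<in> c y" using xy by (auto simp: c_def)
    then obtain W' where "W' \<in> \<B>" "y \<in> W'" "to_nat_on \<B> W = to_nat_on \<B> W'"
      by (auto simp: c_def)
    then have "y \<in> W" using W B(1) by simp
    then show False using W UV by (auto simp: disjnt_iff)
  qed
  then have "topspace S \<lesssim> (UNIV :: nat set set)" by (auto simp: lepoll_def)
  then show ?thesis using nat_sets_eqpoll_reals lepoll_trans2 by blast
qed

lemma condensesI:
  fixes X :: "'a topology" and M :: "'m topology"
  assumes "metrizable_space M" "separable_space M" "continuous_map X M f"
    "inj_on f (topspace X)" "f ` topspace X = topspace M"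
  shows "condenses_onto_separable_metric X"
proof -
  let ?g = "inv_into (topspace X) f"
  have "inj_on ?g (topspace M)" using assms(5) by (metis inj_on_inv_into order_refl)
  then obtain N where N: "homeomorphic_map M N ?g" using homeomorphic_copy by blast
  then have "M homeomorphic_space N" using homeomorphic_map_imp_homeomorphic_space by blast
  then have "metrizable_space N" "separable_space N"
    using assms homeomorphic_metrizable_space homeomorphic_separable_space by blast+
  moreover have "continuous_map X N (?g \<circ> f)"
    using assms(3) N homeomorphic_imp_continuous_map continuous_map_compose by blast
  moreover have "inj_on (?g \<circ> f) (topspace X)" using assms(4) by (simp add: inj_on_def)
  moreover have "(?g \<circ> f) ` topspace X = topspace N"
    using assms(5) homeomorphic_imp_surjective_map[OF N] by (metis image_comp)
  ultimately show ?thesis unfolding condenses_onto_separable_metric_def by blast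
qed

lemma fiberedI:
  fixes K :: "'k topology" and S :: "'s topology"
  assumes "compact_space K" "Hausdorff_space K" "Hausdorff_space S" "second_countable S"
    "continuous_map K S f"
    "\<And>y. y \<in> topspace S \<Longrightarrow>
       finite {x \<in> topspace K. f x = y} \<and> card {x \<in> topspace K. f x = y} \<le> n"
  shows "fibered n K"
proof -
  obtain g :: "'s \<Rightarrow> real" where g: "inj_on g (topspace S)"
    using second_countable_lepoll_reals[OF assms(3,4)] by (auto simp: lepoll_def)
  then obtain R where R: "homeomorphic_map S R g" using homeomorphic_copy by blast
  then have "S homeomorphic_space R" using homeomorphic_map_imp_homeomorphic_space by blast
  then have "Hausdorff_space R" "second_countable R"
    using assms homeomorphic_Hausdorff_space homeomorphic_space_second_countability by blast+
  moreover have "continuous_map K R (g \<circ> f)"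
    using assms(5) R homeomorphic_imp_continuous_map continuous_map_compose by blast
  moreover have "finite {x \<in> topspace K. (g \<circ> f) x = y} \<and> card {x \<in> topspace K. (g \<circ> f) x = y} \<le> n"
    if y: "y \<in> topspace R" for y
  proof -
    obtain s where s: "s \<in> topspace S" "y = g s"
      using y homeomorphic_imp_surjective_map[OF R] by blast
    have "f x \<in> topspace S" if "x \<in> topspace K" for x
      using assms(5) that by (auto simp: continuous_map_def)
    then have "{x \<in> topspace K. (g \<circ> f) x = y} = {x \<in> topspace K. f x = s}"
      using s g by (auto simp: inj_on_def)
    then show ?thesis using assms(6)[OF s(1)] by simp
  qed
  ultimately show ?thesis using assms(1,2) unfolding fibered_def by blast
qed

lemma determinedI:
  fixes K :: "'k topology" and S :: "'s topology"
  assumes "compact_space K" "Hausdorff_space K" "Hausdorff_space S" "second_countable S"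
    "\<And>s. s \<in> topspace S \<Longrightarrow> \<Phi> s \<subseteq> topspace K \<and> finite (\<Phi> s) \<and> card (\<Phi> s) \<le> n"
    "upper_semicontinuous S K \<Phi>" "topspace K = (\<Union>s\<in>topspace S. \<Phi> s)"
  shows "determined n K"
proof -
  obtain g :: "'s \<Rightarrow> real" where g: "inj_on g (topspace S)"
    using second_countable_lepoll_reals[OF assms(3,4)] by (auto simp: lepoll_def)
  then obtain R where R: "homeomorphic_map S R g" using homeomorphic_copy by blast
  then have "S homeomorphic_space R" using homeomorphic_map_imp_homeomorphic_space by blast
  then have SR: "Hausdorff_space R" "second_countable R"
    using assms homeomorphic_Hausdorff_space homeomorphic_space_second_countability by blast+
  obtain h where h: "homeomorphic_maps S R g h" using R homeomorphic_map_maps by blast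
  then have hS: "h y \<in> topspace S" if "y \<in> topspace R" for y
    using that by (auto simp: homeomorphic_maps_def continuous_map_def)
  have "h ` topspace R = topspace S"
    using h homeomorphic_imp_surjective_map homeomorphic_maps_map by blast
  then have "topspace K = (\<Union>s\<in>topspace R. (\<Phi> \<circ> h) s)" using assms(7) by (metis image_comp)
  moreover have "upper_semicontinuous R K (\<Phi> \<circ> h)"
    unfolding upper_semicontinuous_def
  proof (intro allI impI)
    fix V assume "openin K V"
    then have "openin S {s \<in> topspace S. \<Phi> s \<subseteq> V}"
      using assms(6) by (simp add: upper_semicontinuous_def)
    then have "openin R {y \<in> topspace R. h y \<in> {s \<in> topspace S. \<Phi> s \<subseteq> V}}"
      using h unfolding homeomorphic_maps_def continuous_map_def by blast
    moreover have "{y \<in> topspace R. h y \<in> {s \<in> topspace S. \<Phi> s \<subseteq> V}} =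
        {y \<in> topspace R. (\<Phi> \<circ> h) y \<subseteq> V}"
      using hS by auto
    ultimately show "openin R {y \<in> topspace R. (\<Phi> \<circ> h) y \<subseteq> V}" by simp
  qed
  moreover have "\<forall>y\<in>topspace R. (\<Phi> \<circ> h) y \<subseteq> topspace K \<and> finite ((\<Phi> \<circ> h) y) \<and> card ((\<Phi> \<circ> h) y) \<le> n"
    using hS assms(5) by simp
  ultimately show ?thesis using SR assms(1,2) unfolding determined_def by blast
qed

lemma image_of_fiberedI:
  fixes K :: "'k topology" and X :: "'a topology"
  assumes "fibered n K" "continuous_map K X g" "g ` topspace K = topspace X"
  shows "image_of_fibered n X"
proof -
  obtain S :: "real topology" and f where S: "compact_space K" "Hausdorff_space K"
    "Hausdorff_space S" "second_countable S" "continuous_map K S f"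
    and fin: "\<And>y. y \<in> topspace S \<Longrightarrow> finite {x \<in> topspace K. f x = y}"
    and card: "\<And>y. y \<in> topspace S \<Longrightarrow> card {x \<in> topspace K. f x = y} \<le> n"
    using assms(1) unfolding fibered_def by blast
  have fS: "f x \<in> topspace S" if "x \<in> topspace K" for x
    using S(5) that by (auto simp: continuous_map_def)
  define c where "c x = (f x, to_nat_on {z \<in> topspace K. f z = f x} x)" for x
  have "inj_on c (topspace K)"
  proof (rule inj_onI)
    fix x y assume xy: "x \<in> topspace K" "y \<in> topspace K" "c x = c y"
    let ?A = "{z \<in> topspace K. f z = f x}"
    have "countable ?A" using fin[OF fS[OF xy(1)]] by (rule countable_finite)
    moreover have "to_nat_on ?A x = to_nat_on ?A y" "x \<in> ?A" "y \<in> ?A"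
      using xy by (auto simp: c_def)
    ultimately show "x = y" by (metis from_nat_into_to_nat_on)
  qed
  then have "topspace K \<lesssim> (UNIV :: (real \<times> nat) set)" by (auto simp: lepoll_def)
  also have "(UNIV :: (real \<times> nat) set) \<lesssim> (UNIV :: real set)"
  proof -
    obtain a :: "real \<Rightarrow> nat set" where a: "bij a"
      using nat_sets_eqpoll_reals eqpoll_sym unfolding eqpoll_def Pow_UNIV by (metis eqpoll_def)
    obtain b :: "nat set \<Rightarrow> real" where b: "bij b"
      using nat_sets_eqpoll_reals unfolding eqpoll_def by blast
    define e where "e = (\<lambda>(r, k). b (insert (2 * k) ((\<lambda>i. 2 * i + 1) ` a r)))"
    have "inj e"
    proof (rule injI, clarify)
      fix r k r' k' assume "e (r, k) = e (r', k')"
      then have eq: "insert (2 * k) ((\<lambda>i. 2 * i + 1) ` a r) = insert (2 * k') ((\<lambda>i. 2 * i + 1) ` a r')"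
        using bij_is_inj[OF b] by (simp add: e_def inj_eq)
      have "2 * k \<in> insert (2 * k') ((\<lambda>i. 2 * i + 1) ` a r')" using eq by blast
      then have k: "k = k'" by auto presburger
      have ne: "Suc (2 * i) \<noteq> 2 * k" for i k :: nat by presburger
      have "i \<in> a r \<longleftrightarrow> 2 * i + 1 \<in> insert (2 * k) ((\<lambda>i. 2 * i + 1) ` a r)" for i r k
        by (auto simp: ne)
      then have "a r = a r'" using eq by blast
      then show "r = r' \<and> k = k'" using k bij_is_inj[OF a] by (simp add: inj_eq)
    qed
    then show ?thesis by (auto simp: lepoll_def)
  qed
  finally obtain i :: "'k \<Rightarrow> real" where i: "inj_on i (topspace K)" by (auto simp: lepoll_def)
  then obtain L where L: "homeomorphic_map K L i" using homeomorphic_copy by blast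
  then obtain j where j: "homeomorphic_maps K L i j" using homeomorphic_map_maps by blast
  then have jL: "homeomorphic_map L K j" using homeomorphic_maps_map by blast
  have KL: "K homeomorphic_space L" using L homeomorphic_map_imp_homeomorphic_space by blast
  have "fibered n L"
  proof (rule fiberedI)
    show "compact_space L" using KL S homeomorphic_compact_space by blast
    show "Hausdorff_space L" using KL S homeomorphic_Hausdorff_space by blast
    show "continuous_map L S (f \<circ> j)"
      using jL S homeomorphic_imp_continuous_map continuous_map_compose by blast
    fix y assume y: "y \<in> topspace S"
    have "j x \<in> topspace K" if "x \<in> topspace L" for x
      using homeomorphic_imp_surjective_map[OF jL] that by blast
    then have sub: "j ` {x \<in> topspace L. (f \<circ> j) x = y} \<subseteq> {x \<in> topspace K. f x = y}" by auto
    have inj: "inj_on j {x \<in> topspace L. (f \<circ> j) x = y}"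
      using homeomorphic_imp_injective_map[OF jL] by (rule inj_on_subset) auto
    show "finite {x \<in> topspace L. (f \<circ> j) x = y} \<and> card {x \<in> topspace L. (f \<circ> j) x = y} \<le> n"
      using inj_on_finite[OF inj sub fin[OF y]] card_inj_on_le[OF inj sub fin[OF y]] card[OF y] by simp
  qed (use S in auto)
  moreover have "continuous_map L X (g \<circ> j)"
    using jL assms(2) homeomorphic_imp_continuous_map continuous_map_compose by blast
  moreover have "(g \<circ> j) ` topspace L = topspace X"
    using assms(3) homeomorphic_imp_surjective_map[OF jL] by (metis image_comp)
  ultimately show ?thesis unfolding image_of_fibered_def by blast
qed

end

theory Submission
  imports Defs
begin

text \<open>
  The link between (a), (b) and (d) is the set of isolated points of \<open>T\<close>: the tree is
  \<open>\<real>\<close>-embeddable iff this set is a countable union of antichains \<open>A\<^sub>n\<close>.  Given such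
  antichains and an injection \<open>e\<close> of \<open>T\<close> into the sets of natural numbers, the up-sets generated by
  \<open>{m \<in> A\<^sub>n. k \<in> e m}\<close> are clopen and separate the points of \<open>T\<close>, which gives (b).  From a
  continuous injection \<open>h\<close> of \<open>T\<close> into the Hilbert cube \<open>Q\<close> one gets the \<open>2\<close>-fibered compact space
  \<open>graph h \<union> {\<infinity>} \<times> Q\<close>, which projects onto \<open>\<alpha>T\<close>.  Finally, let \<open>\<Phi>\<close> witness (d), and let
  \<open>m\<close> be isolated, \<open>\<Phi> s \<subseteq> {m, u}\<close>.  If \<open>u \<notin> [0, m)\<close>, some basic neighbourhood \<open>U\<close> of
  \<open>s\<close> has \<open>\<Phi>[U]\<close> disjoint from \<open>[0, m)\<close>, and the \<open>m\<close> with the same \<open>U\<close> form an antichain; if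
  \<open>u < m\<close>, some \<open>U\<close> has \<open>\<Phi>[U] \<subseteq> [0, m]\<close>, so that \<open>U\<close> determines \<open>m\<close> as the maximum of \<open>\<Phi>[U]\<close>.
\<close>

section \<open>Antichains and isolated points of a tree\<close>

definition antichain :: "'a::order set \<Rightarrow> bool" where
  "antichain A \<longleftrightarrow> (\<forall>x\<in>A. \<forall>y\<in>A. \<not> x < y)"

text \<open>Only a cover is asked for: the antichains may overlap and may contain points outside
  \<open>S\<close>.\<close>

definition sigma_antichain :: "'a::order set \<Rightarrow> bool" where
  "sigma_antichain S \<longleftrightarrow> (\<exists>A :: nat \<Rightarrow> 'a set. (\<forall>n. antichain (A n)) \<and> S \<subseteq> (\<Union>n. A n))"

definition isolated_points :: "'a::tree set" where
  "isolated_points = {m. openin interval_topology {m}}"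

definition up_closure :: "'a::order set \<Rightarrow> 'a set" where
  "up_closure A = {t. \<exists>m\<in>A. m \<le> t}"

lemma sigma_antichainI:
  assumes "countable \<A>" "\<And>A. A \<in> \<A> \<Longrightarrow> antichain A" "S \<subseteq> \<Union>\<A>"
  shows "sigma_antichain S"
proof (cases "\<A> = {}")
  case True
  then show ?thesis
    using assms(3) unfolding sigma_antichain_def
    by (intro exI[of _ "\<lambda>_. {}"]) (simp add: antichain_def)
next
  case False
  then have "range (from_nat_into \<A>) = \<A>"
    using assms(1) by (rule range_from_nat_into)
  then show ?thesis
    using assms unfolding sigma_antichain_def by (metis rangeI)
qed

text \<open>A minimal element \<open>m\<close> of \<open>{s<..t}\<close> serves, because the open
  set \<open>{s<..m}\<close> is then just \<open>{m}\<close>.\<close>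

lemma isolated_points_between:
  fixes s t :: "'a::tree"
  assumes "s < t"
  obtains m where "m \<in> isolated_points" "s < m" "m \<le> t"
proof -
  have "t \<in> {s<..t}" using assms by simp
  from wfE_min[OF wf_tree_less this] obtain m where m: "m \<in> {s<..t}"
    and min: "\<And>y. (y, m) \<in> {(x, y). x < y} \<Longrightarrow> y \<notin> {s<..t}"
    by blast
  have "x = m" if "s < x" "x \<le> m" for x
  proof -
    have "x \<le> t" using that m by (meson greaterThanAtMost_iff order.trans)
    then show ?thesis using min[of x] that by (auto simp: less_le)
  qed
  then have "{s<..m} \<subseteq> {m}" by auto
  then have "openin interval_topology {m}"
    unfolding openin_interval_topology using m(1) by auto
  then show ?thesis
    using that m(1) unfolding isolated_points_def by auto
qed

text \<open>The points below \<open>m\<close> form a chain, so an open interval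
  \<open>{p<..m}\<close> inside \<open>{m}\<close> makes \<open>p\<close> the immediate predecessor
  of \<open>m\<close>.\<close>

lemma isolated_pointsE:
  fixes m :: "'a::tree"
  assumes "m \<in> isolated_points"
  obtains "m = bot" | p where "p < m" "\<And>x. x < m \<Longrightarrow> x \<le> p"
proof -
  have "m = bot \<or> (\<exists>p<m. {p<..m} \<subseteq> {m})"
    using assms unfolding isolated_points_def openin_interval_topology by blast
  moreover have "x \<le> p" if "p < m" "{p<..m} \<subseteq> {m}" "x < m" for p x
    using that tree_chain[of x m p] by (auto simp: less_le)
  ultimately show ?thesis using that by blast
qed

text \<open>From left to right, a rational number is placed in the jump of the embedding at each
  isolated point. From right to left, each point adds up weights \<open>(1/2) ^ n\<close> over the
  antichains that it has reached.\<close>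

lemma R_embeddable_iff:
  "R_embeddable TYPE('a) \<longleftrightarrow> sigma_antichain (isolated_points :: 'a::tree set)"
proof
  assume "R_embeddable TYPE('a)"
  then obtain f :: "'a \<Rightarrow> real" where f: "strict_mono f"
    unfolding R_embeddable_def by blast
  \<comment> \<open>\<open>A q\<close> collects the points at which \<open>f\<close> jumps past
    \<open>q\<close>. If it contained \<open>p < m\<close>, then \<open>f p \<le> q < f p\<close>
    would follow.\<close>
  define A where "A q = {m. real_of_rat q < f m \<and> (\<forall>p<m. f p \<le> real_of_rat q)}" for q
  show "sigma_antichain (isolated_points :: 'a set)"
  proof (rule sigma_antichainI)
    show "countable (range A)" by simp
    show "antichain B" if "B \<in> range A" for B
      using that unfolding antichain_def A_def by force
    show "isolated_points \<subseteq> \<Union>(range A)"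
    proof
      fix m :: 'a assume "m \<in> isolated_points"
      then have "\<exists>q. m \<in> A q"
      proof (cases rule: isolated_pointsE)
        case 1
        \<comment> \<open>Nothing lies below the root, so any rational below \<open>f m\<close> will
          do.\<close>
        obtain q where "f m - 1 < real_of_rat q" "real_of_rat q < f m"
          using of_rat_dense[of "f m - 1" "f m"] by auto
        then show ?thesis using 1 by (auto simp: A_def)
      next
        case (2 p)
        obtain q where q: "f p < real_of_rat q" "real_of_rat q < f m"
          using of_rat_dense[of "f p" "f m"] strict_monoD[OF f 2(1)] by auto
        have "f x \<le> real_of_rat q" if "x < m" for x
          using monoD[OF strict_mono_mono[OF f] 2(2)[OF that]] q(1) by simp
        then show ?thesis using q by (auto simp: A_def)
      qed
      then show "m \<in> \<Union>(range A)" by blast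
    qed
  qed
next
  assume "sigma_antichain (isolated_points :: 'a set)"
  then obtain A :: "nat \<Rightarrow> 'a set"
    where A: "\<And>n. antichain (A n)" "isolated_points \<subseteq> (\<Union>n. A n)"
    unfolding sigma_antichain_def by blast
  define g where "g t n = (if t \<in> up_closure (A n) then (1/2) ^ n else (0::real))" for t n
  have sum: "summable (g t)" for t
    by (rule summable_comparison_test'[of "\<lambda>n. (1/2::real) ^ n" 0])
       (auto simp: g_def summable_geometric)
  have "strict_mono (\<lambda>t. suminf (g t))"
  proof (rule strict_monoI)
    fix s t :: 'a assume "s < t"
    then obtain m where m: "m \<in> isolated_points" "s < m" "m \<le> t"
      by (rule isolated_points_between)
    then obtain n where n: "m \<in> A n" using A(2) by blast
    have "g s i \<le> g t i" for i
      using \<open>s < t\<close> by (auto simp: g_def up_closure_def intro: order.trans)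
    moreover have "g s n < g t n"
    proof -
      \<comment> \<open>An element of \<open>A n\<close> below \<open>s\<close> would lie strictly
        below \<open>m\<close>, which is in \<open>A n\<close> too.\<close>
      have "s \<notin> up_closure (A n)"
        using A(1)[of n] n m(2) order.strict_trans1 unfolding up_closure_def antichain_def by blast
      moreover have "t \<in> up_closure (A n)" using n m(3) unfolding up_closure_def by blast
      ultimately show ?thesis by (simp add: g_def)
    qed
    ultimately have "0 < (\<Sum>i. g t i - g s i)"
      using suminf_pos2[OF summable_diff[OF sum[of t] sum[of s]], of n] by simp
    then show "suminf (g s) < suminf (g t)"
      using suminf_diff[OF sum[of t] sum[of s]] by simp
  qed
  then show "R_embeddable TYPE('a)" unfolding R_embeddable_def by blast
qed

section \<open>Clopen up-sets and a continuous injection into a separable metric space\<close>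

lemma openin_up_closure:
  fixes A :: "'a::tree set"
  assumes "A \<subseteq> isolated_points"
  shows "openin interval_topology (up_closure A)"
  unfolding openin_interval_topology
proof
  fix t assume "t \<in> up_closure A"
  then obtain m where m: "m \<in> A" "m \<le> t" unfolding up_closure_def by blast
  \<comment> \<open>Isolation takes care of the generators themselves; a point strictly above a
    generator \<open>m\<close> has the neighbourhood \<open>{m<..t}\<close>.\<close>
  show "t = bot \<or> (\<exists>s<t. {s<..t} \<subseteq> up_closure A)"
  proof (cases "m = t")
    case True
    have "openin interval_topology {m}" using assms m unfolding isolated_points_def by blast
    then have "t = bot \<or> (\<exists>s<t. {s<..t} \<subseteq> {m})"
      using True unfolding openin_interval_topology by blast
    moreover have "{m} \<subseteq> up_closure A" using m unfolding up_closure_def by blast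
    ultimately show ?thesis by blast
  next
    case False
    then have "m < t" "{m<..t} \<subseteq> up_closure A" using m unfolding up_closure_def by (auto simp: less_le)
    then show ?thesis by blast
  qed
qed

text \<open>The complement of an up-set is closed downwards, so it contains all of
  \<open>{bot<..t}\<close> with each of its points \<open>t\<close>.\<close>

lemma openin_Compl_up_closure: "openin interval_topology (- up_closure (A :: 'a::tree set))"
  unfolding openin_interval_topology
proof
  fix t assume t: "t \<in> - up_closure A"
  then have "{bot<..t} \<subseteq> - up_closure A" unfolding up_closure_def using order.trans by fastforce
  then show "t = bot \<or> (\<exists>s<t. {s<..t} \<subseteq> - up_closure A)" using bot.not_eq_extremum by blast
qed

lemma continuous_map_up_closure:
  fixes A :: "'a::tree set"
  assumes "A \<subseteq> isolated_points"
  shows "continuous_map interval_topology euclideanreal (\<lambda>t. if t \<in> up_closure A then 1 else 0)"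
  unfolding continuous_map_def
proof (intro conjI allI impI)
  fix U :: "real set"
  let ?V = "{t \<in> topspace interval_topology. (if t \<in> up_closure A then 1 else 0) \<in> U}"
  have "?V = (if 1 \<in> U then up_closure A else {}) \<union> (if 0 \<in> U then - up_closure A else {})" by auto
  then show "openin interval_topology ?V"
    using openin_up_closure[OF assms] openin_Compl_up_closure[of A] by (simp only: openin_Un openin_empty split: if_split) blast
qed simp

text \<open>As \<open>{..x}\<close> is a chain, at most one element \<open>m\<close> of
  \<open>A n\<close> lies below \<open>x\<close>. If there is an isolated one, the up-sets with
  index \<open>n\<close> that contain \<open>x\<close> spell out its code \<open>e m\<close>; since
  \<open>0\<close> is in every code, \<open>k = 0\<close> tells whether there is one.\<close>

lemma separate_points:
  fixes A :: "nat \<Rightarrow> 'a::tree set" and e :: "'a \<Rightarrow> nat set"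
  assumes A: "\<And>n. antichain (A n)" "isolated_points \<subseteq> (\<Union>n. A n)"
    and e: "inj e" "\<And>m. 0 \<in> e m" and "\<not> t \<le> s"
  shows "\<exists>n k. (s \<in> up_closure {m \<in> A n \<inter> isolated_points. k \<in> e m}) \<noteq>
               (t \<in> up_closure {m \<in> A n \<inter> isolated_points. k \<in> e m})"
proof -
  define W where "W n k = up_closure {m \<in> A n \<inter> isolated_points. k \<in> e m}" for n k
  have W: "x \<in> W n k \<longleftrightarrow> k \<in> e m"
    if "m \<in> A n \<inter> isolated_points" "m \<le> x" for x m n k
  proof -
    have "m' = m" if "m' \<in> A n" "m' \<le> x" for m'
      using tree_chain[of m x m'] that \<open>m \<in> A n \<inter> isolated_points\<close> \<open>m \<le> x\<close> A(1)[of n]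
      unfolding antichain_def less_le by blast
    then show ?thesis using that unfolding W_def up_closure_def by auto
  qed
  \<comment> \<open>An isolated point on the way from \<open>inf s t\<close> up to \<open>t\<close>
    lies below \<open>t\<close> but not below \<open>s\<close>.\<close>
  have "inf s t < t" using \<open>\<not> t \<le> s\<close> by (metis inf.cobounded2 inf.cobounded1 less_le)
  then obtain m where m: "m \<in> isolated_points" "inf s t < m" "m \<le> t"
    by (rule isolated_points_between)
  then obtain n where n: "m \<in> A n" using A(2) by blast
  have "\<not> m \<le> s" using m by (meson inf_greatest less_le_not_le)
  have "\<exists>k. (s \<in> W n k) \<noteq> (t \<in> W n k)"
  proof (cases "s \<in> W n 0")
    case False
    then show ?thesis using W[of m n t 0] m n e(2) by blast
  next
    case True
    then obtain m' where m': "m' \<in> A n \<inter> isolated_points" "m' \<le> s"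
      unfolding W_def up_closure_def by blast
    \<comment> \<open>Both \<open>s\<close> and \<open>t\<close> now have an element of
      \<open>A n\<close> below them; these differ, so their codes differ at some
      \<open>k\<close>.\<close>
    then have "e m \<noteq> e m'" using \<open>\<not> m \<le> s\<close> injD[OF e(1)] by blast
    then show ?thesis using W[of m n t] W[OF m'] m n by blast
  qed
  then show ?thesis unfolding W_def by blast
qed

lemma condenses_if_R_embeddable:
  assumes "R_embeddable TYPE('a::tree)" "(UNIV :: 'a set) \<lesssim> (UNIV :: nat set set)"
  shows "condenses_onto_separable_metric (interval_topology :: 'a topology)"
proof -
  obtain A :: "nat \<Rightarrow> 'a set"
    where A: "\<And>n. antichain (A n)" "isolated_points \<subseteq> (\<Union>n. A n)"
    using assms(1) unfolding R_embeddable_iff sigma_antichain_def by blast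
  obtain e0 :: "'a \<Rightarrow> nat set" where "inj e0" using assms(2) by (auto simp: lepoll_def)
  \<comment> \<open>The shift makes room for the common element \<open>0\<close> of all codes and
    keeps them distinct.\<close>
  define e where "e m = insert 0 (Suc ` e0 m)" for m
  have e: "inj e" "0 \<in> e m" for m
  proof -
    have "i \<in> e0 m \<longleftrightarrow> Suc i \<in> e m" for i m by (auto simp: e_def)
    then show "inj e" using \<open>inj e0\<close> by (metis injI injD set_eqI)
  qed (simp add: e_def)
  \<comment> \<open>The antichains merely cover the isolated points; the intersection makes the
    up-closures open.\<close>
  define B where "B = (\<lambda>(n, k). {m \<in> A n \<inter> isolated_points. k \<in> e m})"
  define F :: "'a \<Rightarrow> nat \<times> nat \<Rightarrow> real" where "F t i = (if t \<in> up_closure (B i) then 1 else 0)" for t i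
  have inj: "inj F"
  proof (rule injI, rule ccontr)
    fix s t assume st: "F s = F t" "s \<noteq> t"
    have "s \<in> up_closure (B i) \<longleftrightarrow> t \<in> up_closure (B i)" for i
      using fun_cong[OF st(1), of i] by (simp add: F_def split: if_splits)
    from this[of "(n, k)" for n k] have eq: "s \<in> up_closure {m \<in> A n \<inter> isolated_points. k \<in> e m} \<longleftrightarrow>
        t \<in> up_closure {m \<in> A n \<inter> isolated_points. k \<in> e m}" for n k
      by (simp add: B_def)
    have "\<not> t \<le> s \<or> \<not> s \<le> t" using st(2) by auto
    then show False
      using separate_points[OF A e, of t s] separate_points[OF A e, of s t] eq by blast
  qed
  have "continuous_map interval_topology euclidean F"
    unfolding euclidean_product_topology[symmetric] continuous_map_componentwise_UNIV F_def
    by (intro allI continuous_map_up_closure) (auto simp: B_def)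
  then have "continuous_map interval_topology (top_of_set (range F)) F"
    by (simp add: continuous_map_into_subtopology)
  moreover have "metrizable_space (top_of_set (range F))"
    by (intro metrizable_space_subtopology metrizable_space_euclidean)
  moreover have "separable_space (top_of_set (range F))"
  proof -
    obtain D where D: "countable D" "D \<subseteq> range F" "range F \<subseteq> closure D"
      by (rule separable)
    then show ?thesis unfolding separable_space_def
      by (intro exI[of _ D]) (auto simp: closure_of_subtopology Int_absorb1)
  qed
  ultimately show ?thesis using inj by (intro condensesI[of _ _ F]) auto
qed

section \<open>The Hilbert cube and a 2-fibered space over the compactification\<close>

abbreviation hilbert_cube :: "(nat \<Rightarrow> real) topology" where
  "hilbert_cube \<equiv> product_topology (\<lambda>_. top_of_set {0..1}) UNIV"

lemma compact_space_hilbert_cube: "compact_space hilbert_cube"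
  by (simp add: compact_space_product_topology compact_space_subtopology)

lemma Hausdorff_space_hilbert_cube: "Hausdorff_space hilbert_cube"
  by (simp add: Hausdorff_space_product_topology Hausdorff_space_subtopology)

lemma second_countable_euclidean:
  "second_countable (euclidean :: 'a::second_countable_topology topology)"
proof -
  obtain \<B> :: "'a set set" where "countable \<B>" "topological_basis \<B>"
    using ex_countable_basis by blast
  then show ?thesis
    unfolding second_countable_def
    by (intro exI[of _ \<B>]) (metis open_openin topological_basisE topological_basis_open)
qed

lemma second_countable_hilbert_cube: "second_countable hilbert_cube"
  unfolding subtopology_product_topology[symmetric] euclidean_product_topology
  by (intro second_countable_subtopology second_countable_euclidean)

text \<open>The coordinates are the distances to a countable dense set, truncated at 1.\<close>

lemma continuous_injection_into_hilbert_cube: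
  assumes "condenses_onto_separable_metric X"
  obtains h where "continuous_map X hilbert_cube h" "inj_on h (topspace X)"
proof -
  obtain M :: "'a topology" and f where M: "metrizable_space M" "separable_space M"
    "continuous_map X M f" "inj_on f (topspace X)" "f ` topspace X = topspace M"
    using assms unfolding condenses_onto_separable_metric_def by blast
  obtain m d where md: "Metric_space m d" "M = Metric_space.mtopology m d"
    using M(1) unfolding metrizable_space_def by blast
  interpret Metric_space m d by (rule md(1))
  obtain C where C: "countable C" "C \<subseteq> m" "M closure_of C = m"
    using M(2) unfolding separable_space_def md(2) by auto
  show ?thesis
  proof (cases "C = {}")
    case True
    then have "topspace X = {}" using M(5) C(3) md(2) by simp
    then show ?thesis by (intro that[of "\<lambda>_ _. 0"]) (auto simp: continuous_map_def)
  next
    case False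
    then have ran: "range (from_nat_into C) = C" using C(1) by (rule range_from_nat_into)
    define g where "g x n = min 1 (d x (from_nat_into C n))" for x n
    have "continuous_map M euclideanreal (\<lambda>x. d x (from_nat_into C n))" for n
    proof -
      have "from_nat_into C n \<in> m" using ran C(2) by blast
      then have "continuous_map (mtopology_of (metric (m, d))) euclideanreal
          (\<lambda>x. mdist (metric (m, d)) x (from_nat_into C n))"
        by (intro continuous_map_mdist) auto
      then show ?thesis unfolding md(2) by (simp add: mtopology_of)
    qed
    then have "continuous_map M (top_of_set {0..1}) (\<lambda>x. g x n)" for n
      unfolding g_def by (intro continuous_map_into_subtopology continuous_map_real_min) auto
    then have "continuous_map M hilbert_cube g"
      by (simp add: continuous_map_componentwise_UNIV)
    moreover have "inj_on g m"
    proof (rule inj_onI, rule ccontr)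
      fix x y assume xy: "x \<in> m" "y \<in> m" "g x = g y" "x \<noteq> y"
      \<comment> \<open>With \<open>r \<le> 1\<close>, truncated distances below \<open>r\<close>
        are true distances; with \<open>r \<le> d x y / 2\<close>, no point is closer than
        \<open>r\<close> to both \<open>x\<close> and \<open>y\<close>.\<close>
      define r where "r = min 1 (d x y / 2)"
      have "r > 0" using xy mdist_pos_less by (simp add: r_def)
      then obtain c where c: "c \<in> C" "c \<in> mball x r"
        using C(3) xy(1) unfolding md(2) metric_closure_of by auto
      then obtain n where n: "c = from_nat_into C n" using ran by blast
      have "d x c < r" using c by simp
      then have "g x n < r" by (simp add: g_def n r_def)
      then have "g y n < r" using xy by simp
      then have "d y c < r" by (auto simp: g_def n r_def min_def split: if_splits)
      then show False
        using triangle[of x c y] commute[of c y] \<open>d x c < r\<close> xy c C(2) by (auto simp: r_def)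
    qed
    ultimately show ?thesis
      using M md by (intro that[of "g \<circ> f"] continuous_map_compose[OF M(3)] comp_inj_on) auto
  qed
qed

text \<open>The graph of \<open>h\<close> need not be closed over \<open>None\<close>; adding all of
  \<open>{None} \<times> topspace Q\<close> closes it up. A fibre of the second projection then has
  one point over \<open>None\<close> and, by injectivity of \<open>h\<close>, at most one on the
  graph.\<close>

lemma image_of_fibered_Alexandroff_compactification:
  fixes X :: "'a topology" and Q :: "'q topology"
  assumes "Hausdorff_space (Alexandroff_compactification X)"
    and Q: "compact_space Q" "Hausdorff_space Q" "second_countable Q" "topspace Q \<noteq> {}"
    and h: "continuous_map X Q h" "inj_on h (topspace X)"
  shows "image_of_fibered 2 (Alexandroff_compactification X)"
proof -
  let ?\<alpha> = "Alexandroff_compactification X"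
  let ?P = "prod_topology ?\<alpha> Q"
  define K where "K = {(Some x, h x) | x. x \<in> topspace X} \<union> {None} \<times> topspace Q"
  have hQ: "h x \<in> topspace Q" if "x \<in> topspace X" for x
    using h(1) that by (auto simp: continuous_map_def)
  have KP: "K \<subseteq> topspace ?P" using hQ by (auto simp: K_def)
  have "openin ?P (topspace ?P - K)"
    unfolding openin_prod_topology_alt
  proof (intro allI impI)
    fix z y assume zy: "(z, y) \<in> topspace ?P - K"
    \<comment> \<open>Every pair over \<open>None\<close> belongs to \<open>K\<close>, so only the
      graph has to be avoided.\<close>
    then obtain x where x: "z = Some x" "x \<in> topspace X" "y \<noteq> h x" "y \<in> topspace Q"
      by (auto simp: K_def)
    then obtain A B where AB: "openin Q A" "openin Q B" "y \<in> A" "h x \<in> B" "disjnt A B"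
      using Q(2) hQ unfolding Hausdorff_space_def by metis
    let ?U = "{x \<in> topspace X. h x \<in> B}"
    have "openin ?\<alpha> (Some ` ?U)"
      using h(1) AB(2) by (simp add: continuous_map_def openin_Alexandroff_compactification_image_Some)
    moreover have "Some ` ?U \<times> A \<subseteq> topspace ?P - K"
      using AB(1,5) openin_subset by (fastforce simp: K_def disjnt_iff)
    ultimately show "\<exists>U V. openin ?\<alpha> U \<and> openin Q V \<and> z \<in> U \<and> y \<in> V \<and> U \<times> V \<subseteq> topspace ?P - K"
      using AB x by (intro exI[of _ "Some ` ?U"] exI[of _ A]) auto
  qed
  then have "closedin ?P K" using KP by (simp add: closedin_def)
  moreover have "compact_space ?P"
    using Q(1) by (simp add: compact_space_prod_topology compact_space_Alexandroff_compactification)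
  ultimately have comp: "compact_space (subtopology ?P K)"
    using closedin_compact_space compact_space_subtopology by blast
  have top: "topspace (subtopology ?P K) = K" using KP by auto
  have fib: "fibered 2 (subtopology ?P K)"
  proof (rule fiberedI[OF comp _ Q(2,3)])
    show "Hausdorff_space (subtopology ?P K)"
      using assms(1) Q(2) by (simp add: Hausdorff_space_prod_topology Hausdorff_space_subtopology)
    show "continuous_map (subtopology ?P K) Q snd"
      by (intro continuous_map_from_subtopology continuous_map_snd)
    fix y assume "y \<in> topspace Q"
    let ?F = "{x \<in> topspace (subtopology ?P K). snd x = y}"
    \<comment> \<open>If \<open>y\<close> is not a value of \<open>h\<close>, the second pair is
      arbitrary; \<open>?E\<close> only bounds the fibre from above.\<close>
    let ?E = "{(None, y), (Some (inv_into (topspace X) h y), y)}"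
    have "?F \<subseteq> ?E" using h(2) unfolding top by (auto simp: K_def)
    moreover have "card ?E \<le> 2" by (simp add: card_insert_if)
    ultimately show "finite ?F \<and> card ?F \<le> 2"
      by (meson card_mono finite.emptyI finite.insertI finite_subset order_trans)
  qed
  have "continuous_map (subtopology ?P K) ?\<alpha> fst"
    by (intro continuous_map_from_subtopology continuous_map_fst)
  moreover have "fst ` topspace (subtopology ?P K) = topspace ?\<alpha>"
  proof -
    \<comment> \<open>The point \<open>q\<close> supplies a preimage of \<open>None\<close>.\<close>
    obtain q where "q \<in> topspace Q" using Q(4) by blast
    then have "z \<in> fst ` K" if "z \<in> topspace ?\<alpha>" for z
      using that by (cases z) (force simp: K_def)+
    then show ?thesis using KP unfolding top by auto
  qed
  ultimately show ?thesis by (rule image_of_fiberedI[OF fib])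
qed

section \<open>From images of fibered spaces to determined spaces\<close>

lemma determined_if_image_of_fibered:
  assumes "Hausdorff_space X" "image_of_fibered n X"
  shows "determined n X"
proof -
  obtain K :: "real topology" and g where g: "fibered n K" "continuous_map K X g"
    "g ` topspace K = topspace X"
    using assms(2) unfolding image_of_fibered_def by blast
  then obtain S :: "real topology" and f where K: "compact_space K" "Hausdorff_space K"
    and S: "Hausdorff_space S" "second_countable S" and f: "continuous_map K S f"
    and fin: "\<And>y. y \<in> topspace S \<Longrightarrow> finite {x \<in> topspace K. f x = y}"
    and card: "\<And>y. y \<in> topspace S \<Longrightarrow> card {x \<in> topspace K. f x = y} \<le> n"
    unfolding fibered_def by blast
  define \<Phi> where "\<Phi> s = g ` {x \<in> topspace K. f x = s}" for s
  show ?thesis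
  proof (rule determinedI)
    show "compact_space X"
      using K(1) g(2,3) image_compactin unfolding compact_space_def by metis
    show "upper_semicontinuous S X \<Phi>" unfolding upper_semicontinuous_def
    proof (intro allI impI)
      fix V assume V: "openin X V"
      \<comment> \<open>The points \<open>s\<close> with \<open>\<Phi> s\<close> not inside
        \<open>V\<close> form the image of \<open>?C\<close> under \<open>f\<close>, which is
        compact and therefore closed.\<close>
      let ?C = "{x \<in> topspace K. g x \<in> topspace X - V}"
      have "closedin K ?C" using g(2) V by (intro closedin_continuous_map_preimage) auto
      then have "closedin S (f ` ?C)"
        using compactin_imp_closedin[OF S(1) image_compactin[OF closedin_compact_space[OF K(1)] f]]
        by blast
      moreover have "{s \<in> topspace S. \<Phi> s \<subseteq> V} = topspace S - f ` ?C"
        using g(3) by (auto simp: \<Phi>_def)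
      ultimately show "openin S {s \<in> topspace S. \<Phi> s \<subseteq> V}" by auto
    qed
    show "topspace X = (\<Union>s\<in>topspace S. \<Phi> s)"
      using f unfolding g(3)[symmetric] by (auto simp: \<Phi>_def continuous_map_def)
    fix s assume s: "s \<in> topspace S"
    show "\<Phi> s \<subseteq> topspace X \<and> finite (\<Phi> s) \<and> card (\<Phi> s) \<le> n"
      using fin[OF s] card[OF s] card_image_le[OF fin[OF s], of g] g(3)
      unfolding \<Phi>_def by auto
  qed (use assms S in auto)
qed

section \<open>Cardinality and embeddability from a determined compactification\<close>

lemma lepoll_reals_if_determined:
  assumes "determined n X"
  shows "topspace X \<lesssim> (UNIV :: real set)"
  including cardinal_syntax
proof -
  obtain S :: "real topology" and \<Phi> where \<Phi>: "\<And>s. s \<in> topspace S \<Longrightarrow> finite (\<Phi> s)"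
    "topspace X = (\<Union>s\<in>topspace S. \<Phi> s)"
    using assms unfolding determined_def by blast
  have "|\<Phi> s| \<le>o |UNIV :: real set|" if "s \<in> topspace S" for s
  proof -
    have "\<Phi> s \<lesssim> (UNIV :: real set)"
      using \<Phi>(1)[OF that] infinite_UNIV_char_0 by (rule finite_lepoll_infinite[rotated])
    then show ?thesis unfolding lepoll_def card_of_ordLeq .
  qed
  \<comment> \<open>The index set consists of reals, so this is a union of at most continuum many
    finite sets.\<close>
  then have "|\<Union>s\<in>topspace S. \<Phi> s| \<le>o |UNIV :: real set|"
    by (intro card_of_UNION_ordLeq_infinite) (auto simp: infinite_UNIV_char_0 card_of_mono1)
  then show ?thesis unfolding \<Phi>(2) lepoll_def card_of_ordLeq .
qed

lemma R_embeddable_if_determined: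
  assumes "determined 2 (one_point_compactification :: 'a::tree option topology)"
  shows "R_embeddable TYPE('a)"
proof -
  let ?\<alpha> = "one_point_compactification :: 'a option topology"
  obtain S :: "real topology" and \<Phi> where "second_countable S"
    and fin: "\<forall>s\<in>topspace S. \<Phi> s \<subseteq> topspace ?\<alpha> \<and> finite (\<Phi> s) \<and> card (\<Phi> s) \<le> 2"
    and usc: "upper_semicontinuous S ?\<alpha> \<Phi>"
    and cover: "topspace ?\<alpha> = (\<Union>s\<in>topspace S. \<Phi> s)"
    using assms unfolding determined_def by (elim conjE exE) blast
  obtain \<B> where \<B>: "countable \<B>"
    "\<And>U s. openin S U \<Longrightarrow> s \<in> U \<Longrightarrow> \<exists>B\<in>\<B>. s \<in> B \<and> B \<subseteq> U"
    using \<open>second_countable S\<close> unfolding second_countable_def by metis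
  \<comment> \<open>\<open>P B\<close> is the part of \<open>\<Phi>[B]\<close> in the tree.
    \<open>A1 B\<close> holds at most its maximum, \<open>A2 B\<close> its minimal elements; both
    are antichains.\<close>
  define P where "P B = {x. Some x \<in> (\<Union>s\<in>B. \<Phi> s)}" for B
  define A1 where "A1 B = {m \<in> P B. P B \<subseteq> {..m}}" for B
  define A2 where "A2 B = {m \<in> P B. P B \<inter> {..<m} = {}}" for B
  \<comment> \<open>Upper semicontinuity shrinks a neighbourhood of \<open>s\<close> to a basic set
    \<open>B\<close> whose values all stay in \<open>V\<close>.\<close>
  have basis: "\<exists>B\<in>\<B>. m \<in> P B \<and> P B \<subseteq> Some -` V"
    if "openin ?\<alpha> V" "s \<in> topspace S" "Some m \<in> \<Phi> s" "\<Phi> s \<subseteq> V" for V s m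
  proof -
    have "openin S {s \<in> topspace S. \<Phi> s \<subseteq> V}"
      using usc \<open>openin ?\<alpha> V\<close> unfolding upper_semicontinuous_def by blast
    then obtain B where "B \<in> \<B>" "s \<in> B" "B \<subseteq> {s \<in> topspace S. \<Phi> s \<subseteq> V}"
      using \<B>(2)[of _ s] \<open>s \<in> topspace S\<close> \<open>\<Phi> s \<subseteq> V\<close> by blast
    then show ?thesis using \<open>Some m \<in> \<Phi> s\<close> unfolding P_def by blast
  qed
  have "sigma_antichain (isolated_points :: 'a set)"
  proof (rule sigma_antichainI)
    show "countable (A1 ` \<B> \<union> A2 ` \<B>)" using \<B>(1) by simp
    show "antichain A" if "A \<in> A1 ` \<B> \<union> A2 ` \<B>" for A
      using that unfolding antichain_def A1_def A2_def by auto
    show "isolated_points \<subseteq> \<Union>(A1 ` \<B> \<union> A2 ` \<B>)"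
    proof
      fix m :: 'a assume "m \<in> isolated_points"
      then have iso: "openin interval_topology {m}" by (simp add: isolated_points_def)
      obtain s where s: "s \<in> topspace S" "Some m \<in> \<Phi> s" using cover by auto
      have "finite (\<Phi> s)" "card (\<Phi> s) \<le> 2" using fin s(1) by blast+
      then have "card (\<Phi> s - {Some m}) \<le> Suc 0" using s(2) by simp
      then have "\<forall>x\<in>\<Phi> s - {Some m}. \<forall>y\<in>\<Phi> s - {Some m}. x = y"
        using \<open>finite (\<Phi> s)\<close> by (simp add: card_le_Suc0_iff_eq)
      \<comment> \<open>If \<open>\<Phi> s\<close> is a singleton, \<open>u\<close> is arbitrary; it
        may also be \<open>None\<close>, which falls under the second case below.\<close>
      then obtain u where u: "\<Phi> s \<subseteq> {Some m, u}" by blast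
      show "m \<in> \<Union>(A1 ` \<B> \<union> A2 ` \<B>)"
      proof (cases "u \<in> Some ` {..<m}")
        case True
        \<comment> \<open>Staying inside \<open>{..m}\<close> makes \<open>m\<close> the maximum of
          \<open>P B\<close>.\<close>
        let ?V = "Some ` {..m}"
        have "openin ?\<alpha> ?V"
          by (simp add: openin_Alexandroff_compactification_image_Some openin_interval_atMost)
        moreover have "\<Phi> s \<subseteq> ?V" using u True by auto
        ultimately obtain B where "B \<in> \<B>" "m \<in> P B" "P B \<subseteq> Some -` ?V"
          using basis s by blast
        then have "m \<in> A1 B" unfolding A1_def by auto
        then show ?thesis using \<open>B \<in> \<B>\<close> by blast
      next
        case False
        \<comment> \<open>Avoiding \<open>{..<m}\<close> makes \<open>m\<close> minimal in
          \<open>P B\<close>. The set is open at \<open>m\<close> because \<open>m\<close> is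
          isolated, and it is a neighbourhood of \<open>None\<close> because it omits only points of
          the compact interval \<open>{..m}\<close>.\<close>
        let ?V = "- Some ` {..<m}"
        have V: "Some -` ?V = {m} \<union> - {..m}" by (auto simp: less_le)
        have "closedin interval_topology {..m}"
          using compactin_interval_atMost Hausdorff_interval_topology compactin_imp_closedin by blast
        then have "openin interval_topology (- {..m})"
          by (simp add: closedin_def Compl_eq_Diff_UNIV)
        then have "openin interval_topology ({m} \<union> - {..m})" using iso by blast
        then have "openin ?\<alpha> ?V"
          unfolding openin_one_point_compactification V by (intro conjI impI exI[of _ "{m}"]) auto
        moreover have "\<Phi> s \<subseteq> ?V" using u False by auto
        ultimately obtain B where "B \<in> \<B>" "m \<in> P B" "P B \<subseteq> Some -` ?V"
          using basis s by blast
        then have "m \<in> A2 B" unfolding A2_def by auto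
        then show ?thesis using \<open>B \<in> \<B>\<close> by blast
      qed
    qed
  qed
  then show ?thesis by (simp add: R_embeddable_iff)
qed

section \<open>The cycle of implications from (a) through (b), (c) and (d) back to (a)\<close>

theorem theorem3p3:
  defines "T \<equiv> interval_topology :: 'a::tree topology"
    and "\<alpha>T \<equiv> one_point_compactification :: 'a option topology"
  shows "(R_embeddable TYPE('a) \<and> (UNIV :: 'a set) \<lesssim> (UNIV :: nat set set)
            \<longleftrightarrow> condenses_onto_separable_metric T)
       \<and> (condenses_onto_separable_metric T \<longleftrightarrow> image_of_fibered 2 \<alpha>T)
       \<and> (image_of_fibered 2 \<alpha>T \<longleftrightarrow> determined 2 \<alpha>T)"
proof -
  have ab: "condenses_onto_separable_metric T"
    if "R_embeddable TYPE('a)" "(UNIV :: 'a set) \<lesssim> (UNIV :: nat set set)"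
    using condenses_if_R_embeddable[OF that] unfolding T_def .
  have bc: "image_of_fibered 2 \<alpha>T" if b: "condenses_onto_separable_metric T"
  proof -
    obtain h where "continuous_map T hilbert_cube h" "inj_on h (topspace T)"
      using continuous_injection_into_hilbert_cube[OF b] .
    moreover have "topspace hilbert_cube \<noteq> {}" by (simp add: PiE_eq_empty_iff)
    ultimately show ?thesis
      unfolding T_def \<alpha>T_def
      using image_of_fibered_Alexandroff_compactification Hausdorff_one_point_compactification
        compact_space_hilbert_cube Hausdorff_space_hilbert_cube second_countable_hilbert_cube
      by blast
  qed
  have cd: "determined 2 \<alpha>T" if "image_of_fibered 2 \<alpha>T"
    using determined_if_image_of_fibered[OF _ that] Hausdorff_one_point_compactification
    unfolding \<alpha>T_def by blast
  have da: "R_embeddable TYPE('a)" "(UNIV :: 'a set) \<lesssim> (UNIV :: nat set set)"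
    if "determined 2 \<alpha>T"
  proof -
    show "R_embeddable TYPE('a)" using R_embeddable_if_determined that unfolding \<alpha>T_def .
    have "(UNIV :: 'a set) \<lesssim> topspace \<alpha>T"
      unfolding \<alpha>T_def lepoll_def by (intro exI[of _ Some]) auto
    also have "\<dots> \<lesssim> (UNIV :: real set)" using lepoll_reals_if_determined[OF that] .
    also have "\<dots> \<approx> (UNIV :: nat set set)" using nat_sets_eqpoll_reals eqpoll_sym by blast
    finally show "(UNIV :: 'a set) \<lesssim> (UNIV :: nat set set)" .
  qed
  show ?thesis using ab bc cd da by blast
qed

end
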